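(* Let $\Bbbk$ be a field, $n\ge 1$, and let $B=\Bbbk^{\oplus n}$ with its fixed pointwise algebra structure. Let $B_1=(B,\Delta_1,\varepsilon_1)$ and $B_2=(B,\Delta_2,\varepsilon_2)$ be two bialgebra structures on $B$, and let $S_1$ and $S_2$ be the corresponding monoids on the set $\{1,\dots,n\}$. Then $B_1$ is isomorphic to $B_2$ as a bialgebra if and only if $S_1$ is isomorphic to $S_2$ as a monoid.
   Context: $B=\Bbbk e_1\oplus\cdots\oplus\Bbbk e_n$ where $e_ie_j=\delta_{ij}e_i$ and $1_B=e_1+\cdots+e_n$. A bialgebra structure on $B$ is a pair $(\Delta,\varepsilon)$ making $B$ a coassociative counital coalgebra such that $\Delta$ and $\varepsilon$ are unital algebra morphisms. The monoid corresponding to such a structure: write $\Delta(e_k)=\sum_{i,j=1}^n a_{ij}^k\,e_i\otimes e_j$; for every pair $(i,j)$ there is exactly one $k$ with $a_{ij}^k=1$ (the other coefficients $a_{ij}^{k'}$ are $0$), and one sets $i\cdot j=k$. This makes $\{1,\dots,n\}$ a monoid whose identity is the unique index $i$ with $\varepsilon(e_i)=1$. A bialgebra isomorphism is a bijective linear map that is both an algebra and a coalgebra morphism. *)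

theory Defs
  imports "HOL-Analysis.Cartesian_Space" "HOL-Algebra.Group"
begin

text \<open>
  The algebra \<open>B = \<k> e\<^sub>1 \<oplus> \<dots> \<oplus> \<k> e\<^sub>n\<close> is the type \<^typ>\<open>'k::field ^ 'n\<close> for a finite index type
  \<open>'n\<close> in the role of \<open>{1,\<dots>,n}\<close>, with the componentwise ring structure of the library; \<open>e\<^sub>i\<close> is
  \<^term>\<open>axis i 1\<close>. The tensor product of \<^typ>\<open>'k::field ^ 'm\<close> and \<^typ>\<open>'k::field ^ 'n\<close> is
  \<open>'k ^ ('m \<times> 'n)\<close>, with \<open>e\<^sub>i \<otimes> e\<^sub>j\<close> the basis vector at \<open>(i, j)\<close>; lemma \<open>tensor_universal\<close>
  below is its universal property, and \<open>pure_tensor_mult\<close> and \<open>pure_tensor_one\<close> show that its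
  componentwise ring structure is the tensor product algebra structure.
\<close>

definition pure_tensor ::
    "'k::field ^ 'm \<Rightarrow> 'k ^ 'n \<Rightarrow> 'k ^ ('m::finite \<times> 'n::finite)"
  where "pure_tensor u v = (\<chi> p. u $ fst p * v $ snd p)"

definition bilinear_map :: "('k::field ^ 'm \<Rightarrow> 'k ^ 'n \<Rightarrow> 'k ^ 'p) \<Rightarrow> bool"
  where "bilinear_map b \<longleftrightarrow>
    (\<forall>v. Vector_Spaces.linear (*s) (*s) (\<lambda>u. b u v)) \<and>
    (\<forall>u. Vector_Spaces.linear (*s) (*s) (b u))"

text \<open>The linear map on the tensor product induced by a bilinear map \<open>b\<close>.\<close>

definition tensor_lift ::
    "('k::field ^ 'm \<Rightarrow> 'k ^ 'n \<Rightarrow> 'k ^ 'p) \<Rightarrow> 'k ^ ('m::finite \<times> 'n::finite) \<Rightarrow> 'k ^ 'p"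
  where "tensor_lift b t = (\<Sum>i\<in>UNIV. \<Sum>j\<in>UNIV. t $ (i, j) *s b (axis i 1) (axis j 1))"

definition tensor_map ::
    "('k::field ^ 'm \<Rightarrow> 'k ^ 'p) \<Rightarrow> ('k ^ 'n \<Rightarrow> 'k ^ 'q) \<Rightarrow>
      'k ^ ('m::finite \<times> 'n::finite) \<Rightarrow> 'k ^ ('p::finite \<times> 'q::finite)"
  where "tensor_map f g = tensor_lift (\<lambda>u v. pure_tensor (f u) (g v))"

text \<open>The canonical isomorphism sending \<open>(u \<otimes> v) \<otimes> w\<close> to \<open>u \<otimes> (v \<otimes> w)\<close>.\<close>

definition tensor_assoc ::
    "'k::field ^ (('m::finite \<times> 'n::finite) \<times> 'p::finite) \<Rightarrow> 'k ^ ('m \<times> ('n \<times> 'p))"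
  where "tensor_assoc t = (\<chi> p. t $ ((fst p, fst (snd p)), snd (snd p)))"

text \<open>
  The two counit axioms are \<open>(\<epsilon> \<otimes> id) \<circ> \<Delta> = id\<close> and \<open>(id \<otimes> \<epsilon>) \<circ> \<Delta> = id\<close> modulo the
  canonical isomorphisms \<open>\<k> \<otimes> B \<cong> B\<close> and \<open>B \<otimes> \<k> \<cong> B\<close>, so that \<open>\<epsilon> \<otimes> id\<close> sends \<open>u \<otimes> v\<close> to \<open>\<epsilon>(u) v\<close>
  and \<open>id \<otimes> \<epsilon>\<close> sends \<open>u \<otimes> v\<close> to \<open>\<epsilon>(v) u\<close>.
\<close>

definition coalgebra_structure ::
    "('k::field ^ 'n \<Rightarrow> 'k ^ ('n \<times> 'n)) \<Rightarrow> ('k ^ 'n::finite \<Rightarrow> 'k) \<Rightarrow> bool"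
  where "coalgebra_structure \<Delta> \<epsilon> \<longleftrightarrow>
    Vector_Spaces.linear (*s) (*s) \<Delta> \<and>
    Vector_Spaces.linear (*s) (*) \<epsilon> \<and>
    (\<forall>x. tensor_assoc (tensor_map \<Delta> id (\<Delta> x)) = tensor_map id \<Delta> (\<Delta> x)) \<and>
    (\<forall>x. tensor_lift (\<lambda>u v. \<epsilon> u *s v) (\<Delta> x) = x) \<and>
    (\<forall>x. tensor_lift (\<lambda>u v. \<epsilon> v *s u) (\<Delta> x) = x)"

definition unital_algebra_hom ::
    "('k::field \<Rightarrow> 'a::ring_1 \<Rightarrow> 'a) \<Rightarrow> ('k \<Rightarrow> 'b::ring_1 \<Rightarrow> 'b) \<Rightarrow> ('a \<Rightarrow> 'b) \<Rightarrow> bool"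
  where "unital_algebra_hom s1 s2 f \<longleftrightarrow>
    Vector_Spaces.linear s1 s2 f \<and> (\<forall>x y. f (x * y) = f x * f y) \<and> f 1 = 1"

definition bialgebra_structure ::
    "('k::field ^ 'n \<Rightarrow> 'k ^ ('n \<times> 'n)) \<Rightarrow> ('k ^ 'n::finite \<Rightarrow> 'k) \<Rightarrow> bool"
  where "bialgebra_structure \<Delta> \<epsilon> \<longleftrightarrow>
    coalgebra_structure \<Delta> \<epsilon> \<and>
    unital_algebra_hom (*s) (*s) \<Delta> \<and>
    unital_algebra_hom (*s) (*) \<epsilon>"

definition coalgebra_hom ::
    "('k::field ^ 'm \<Rightarrow> 'k ^ ('m \<times> 'm)) \<Rightarrow> ('k ^ 'm \<Rightarrow> 'k) \<Rightarrow>
      ('k ^ 'n \<Rightarrow> 'k ^ ('n \<times> 'n)) \<Rightarrow> ('k ^ 'n \<Rightarrow> 'k) \<Rightarrow>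
      ('k ^ 'm::finite \<Rightarrow> 'k ^ 'n::finite) \<Rightarrow> bool"
  where "coalgebra_hom \<Delta>1 \<epsilon>1 \<Delta>2 \<epsilon>2 f \<longleftrightarrow>
    Vector_Spaces.linear (*s) (*s) f \<and>
    (\<forall>x. \<Delta>2 (f x) = tensor_map f f (\<Delta>1 x)) \<and>
    (\<forall>x. \<epsilon>2 (f x) = \<epsilon>1 x)"

definition bialgebra_isomorphic ::
    "('k::field ^ 'n \<Rightarrow> 'k ^ ('n \<times> 'n)) \<Rightarrow> ('k ^ 'n \<Rightarrow> 'k) \<Rightarrow>
      ('k ^ 'n \<Rightarrow> 'k ^ ('n \<times> 'n)) \<Rightarrow> ('k ^ 'n::finite \<Rightarrow> 'k) \<Rightarrow> bool"
  where "bialgebra_isomorphic \<Delta>1 \<epsilon>1 \<Delta>2 \<epsilon>2 \<longleftrightarrow>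
    (\<exists>f. bij f \<and> unital_algebra_hom (*s) (*s) f \<and> coalgebra_hom \<Delta>1 \<epsilon>1 \<Delta>2 \<epsilon>2 f)"

text \<open>
  The coefficient of \<open>e\<^sub>i \<otimes> e\<^sub>j\<close> in \<open>\<Delta>(e\<^sub>k)\<close> is \<^term>\<open>\<Delta> (axis k 1) $ (i, j)\<close>. Both definite descriptions
  are justified for bialgebra structures by \<open>bialgebra_coeff_ex1\<close> and \<open>bialgebra_counit_ex1\<close>,
  and the result is a monoid by \<open>monoid_bialgebra_monoid\<close>.
\<close>

definition bialgebra_monoid ::
    "('k::field ^ 'n \<Rightarrow> 'k ^ ('n \<times> 'n)) \<Rightarrow> ('k ^ 'n::finite \<Rightarrow> 'k) \<Rightarrow> 'n monoid"
  where "bialgebra_monoid \<Delta> \<epsilon> =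
    \<lparr> carrier = UNIV,
      monoid.mult = (\<lambda>i j. THE k. \<Delta> (axis k 1) $ (i, j) = 1),
      one = (THE i. \<epsilon> (axis i 1) = 1) \<rparr>"

text \<open>The library's \<^const>\<open>hom\<close> and \<^const>\<open>iso\<close> do not mention the identity element.\<close>

definition monoid_isomorphic :: "('a, 'c) monoid_scheme \<Rightarrow> ('b, 'd) monoid_scheme \<Rightarrow> bool"
  where "monoid_isomorphic S T \<longleftrightarrow> (\<exists>h \<in> iso S T. h \<one>\<^bsub>S\<^esub> = \<one>\<^bsub>T\<^esub>)"


subsection \<open>Properties of the tensor product\<close>

lemma pure_tensor_axis: "pure_tensor (axis i 1) (axis j 1) = axis (i, j) (1 :: 'k::field)"
  by (auto simp: pure_tensor_def axis_def vec_eq_iff)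

lemma pure_tensor_mult: "pure_tensor u v * pure_tensor u' v' = pure_tensor (u * u') (v * v')"
  by (simp add: pure_tensor_def vec_eq_iff)

lemma pure_tensor_one: "pure_tensor 1 1 = 1"
  by (simp add: pure_tensor_def vec_eq_iff)

lemma tensor_assoc_pure:
  "tensor_assoc (pure_tensor (pure_tensor u v) w) = pure_tensor u (pure_tensor v w)"
  by (simp add: tensor_assoc_def pure_tensor_def vec_eq_iff mult.assoc)

lemma vec_linearI:
  fixes f :: "'k::field ^ 'm \<Rightarrow> 'k ^ 'p"
  assumes "\<And>x y. f (x + y) = f x + f y" and "\<And>c x. f (c *s x) = c *s f x"
  shows "Vector_Spaces.linear (*s) (*s) f"
  using assms by unfold_locales auto

lemma bilinear_pure_tensor: "bilinear_map pure_tensor"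
  unfolding bilinear_map_def
  by (auto intro!: vec_linearI simp: pure_tensor_def vec_eq_iff algebra_simps)

lemma linear_axis_expansion:
  fixes f :: "'k::field ^ 'm \<Rightarrow> 'k ^ 'p"
  assumes "Vector_Spaces.linear (*s) (*s) f"
  shows "f x = (\<Sum>i\<in>UNIV. x $ i *s f (axis i 1))"
proof -
  have "f x = f (\<Sum>i\<in>UNIV. x $ i *s axis i 1)"
    by (simp add: basis_expansion)
  then show ?thesis
    by (simp add: vec.linear_sum[OF assms] vec.linear_scale[OF assms])
qed

lemma linear_tensor_lift: "Vector_Spaces.linear (*s) (*s) (tensor_lift b)"
  by (rule vec_linearI)
    (simp_all add: tensor_lift_def vector_sadd_rdistrib sum.distrib vec.scale_sum_right)

lemma tensor_universal:
  assumes b: "bilinear_map b"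
  shows "Vector_Spaces.linear (*s) (*s) f \<and> (\<forall>u v. f (pure_tensor u v) = b u v)
    \<longleftrightarrow> f = tensor_lift b"
proof (intro iffI conjI allI)
  assume *: "Vector_Spaces.linear (*s) (*s) f \<and> (\<forall>u v. f (pure_tensor u v) = b u v)"
  show "f = tensor_lift b"
  proof
    fix t
    have "f t = (\<Sum>p\<in>UNIV. t $ p *s f (axis p 1))"
      using * linear_axis_expansion by blast
    also have "\<dots> = (\<Sum>p\<in>UNIV. t $ p *s b (axis (fst p) 1) (axis (snd p) 1))"
      using * by (metis pure_tensor_axis prod.collapse)
    also have "\<dots> = tensor_lift b t"
      by (simp add: tensor_lift_def UNIV_Times_UNIV[symmetric] sum.cartesian_product split_def
          del: UNIV_Times_UNIV)
    finally show "f t = tensor_lift b t" .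
  qed
next
  assume f: "f = tensor_lift b"
  show "Vector_Spaces.linear (*s) (*s) f"
    by (simp add: f linear_tensor_lift)
  fix u v
  have "b u v = (\<Sum>i\<in>UNIV. u $ i *s b (axis i 1) v)"
    using linear_axis_expansion[of "\<lambda>u. b u v" u] b by (simp add: bilinear_map_def)
  also have "\<dots> = (\<Sum>i\<in>UNIV. u $ i *s (\<Sum>j\<in>UNIV. v $ j *s b (axis i 1) (axis j 1)))"
    using linear_axis_expansion[of "b (axis _ 1)" v] b by (simp add: bilinear_map_def)
  finally show "f (pure_tensor u v) = b u v"
    by (simp add: f tensor_lift_def pure_tensor_def vec.scale_sum_right)
qed


subsection \<open>The monoid of a bialgebra structure\<close>

lemma orthogonal_idempotents_ex1:
  fixes c :: "'i::finite \<Rightarrow> 'k::field"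
  assumes orth: "\<And>k l. c k * c l = (if k = l then c k else 0)"
    and sum: "(\<Sum>k\<in>UNIV. c k) = 1"
  shows "\<exists>!k. c k = 1" and "c k = 1 \<or> c k = 0"
proof -
  have *: "c k = 1 \<or> c k = 0" for k
    using orth[of k k] by auto
  then show "c k = 1 \<or> c k = 0" .
  have "\<exists>k. c k = 1"
  proof (rule ccontr)
    assume "\<nexists>k. c k = 1"
    with * have "(\<Sum>k\<in>UNIV. c k) = 0" by simp
    with sum show False by simp
  qed
  moreover have "k = l" if "c k = 1" "c l = 1" for k l
    using orth[of k l] that by (auto split: if_splits)
  ultimately show "\<exists>!k. c k = 1" by blast
qed

lemma axis_mult_axis: "axis k 1 * axis l 1 = (if k = l then axis k 1 else (0 :: 'k::field ^ 'n))"
  by (auto simp: axis_def vec_eq_iff)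

lemma sum_axis: "(\<Sum>k\<in>UNIV. axis k 1) = (1 :: 'k::field ^ 'n)"
  by (simp add: vec_eq_iff axis_def)

lemma
  fixes \<Delta> :: "'k::field ^ 'n::finite \<Rightarrow> 'k ^ ('n \<times> 'n)"
  assumes "bialgebra_structure \<Delta> \<epsilon>"
  shows bialgebra_coeff_ex1: "\<exists>!k. \<Delta> (axis k 1) $ (i, j) = 1"
    and bialgebra_coeff_cases: "\<Delta> (axis k 1) $ (i, j) = 1 \<or> \<Delta> (axis k 1) $ (i, j) = 0"
proof -
  have lin: "Vector_Spaces.linear (*s) (*s) \<Delta>"
    and mult: "\<And>x y. \<Delta> (x * y) = \<Delta> x * \<Delta> y" and one: "\<Delta> 1 = 1"
    using assms by (auto simp: bialgebra_structure_def unital_algebra_hom_def)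
  have "\<Delta> (axis k 1) $ (i, j) * \<Delta> (axis l 1) $ (i, j) =
      (if k = l then \<Delta> (axis k 1) $ (i, j) else 0)" for k l
    using arg_cong[OF mult[of "axis k 1" "axis l 1"], of "\<lambda>t. t $ (i, j)"]
    by (simp add: axis_mult_axis vec.linear_0[OF lin] split: if_splits)
  moreover have "(\<Sum>k\<in>UNIV. \<Delta> (axis k 1) $ (i, j)) = 1"
    using one by (simp flip: sum_axis sum_component add: vec.linear_sum[OF lin])
      (simp add: sum_axis)
  ultimately show "\<exists>!k. \<Delta> (axis k 1) $ (i, j) = 1"
    and "\<Delta> (axis k 1) $ (i, j) = 1 \<or> \<Delta> (axis k 1) $ (i, j) = 0"
    using orthogonal_idempotents_ex1[of "\<lambda>k. \<Delta> (axis k 1) $ (i, j)"] by blast+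
qed

lemma bialgebra_counit_ex1:
  fixes \<epsilon> :: "'k::field ^ 'n::finite \<Rightarrow> 'k"
  assumes "bialgebra_structure \<Delta> \<epsilon>"
  shows "\<exists>!i. \<epsilon> (axis i 1) = 1"
proof (rule orthogonal_idempotents_ex1(1))
  have lin: "Vector_Spaces.linear (*s) (*) \<epsilon>"
    and mult: "\<And>x y. \<epsilon> (x * y) = \<epsilon> x * \<epsilon> y" and one: "\<epsilon> 1 = 1"
    using assms by (auto simp: bialgebra_structure_def unital_algebra_hom_def)
  interpret Vector_Spaces.linear "(*s)" "(*)" \<epsilon> by (fact lin)
  show "\<epsilon> (axis k 1) * \<epsilon> (axis l 1) = (if k = l then \<epsilon> (axis k 1) else 0)" for k l
    by (simp add: axis_mult_axis zero flip: mult)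
  show "(\<Sum>k\<in>UNIV. \<epsilon> (axis k 1)) = 1"
    by (simp add: sum_axis one flip: sum)
qed

lemma comult_nth:
  fixes \<Delta> :: "'k::field ^ 'n::finite \<Rightarrow> 'k ^ ('n \<times> 'n)"
  assumes "bialgebra_structure \<Delta> \<epsilon>"
  shows "\<Delta> x $ (i, j) = x $ (i \<otimes>\<^bsub>bialgebra_monoid \<Delta> \<epsilon>\<^esub> j)"
proof -
  have lin: "Vector_Spaces.linear (*s) (*s) \<Delta>"
    using assms by (auto simp: bialgebra_structure_def unital_algebra_hom_def)
  define m where "m = i \<otimes>\<^bsub>bialgebra_monoid \<Delta> \<epsilon>\<^esub> j"
  have m: "\<Delta> (axis m 1) $ (i, j) = 1"
    using theI'[OF bialgebra_coeff_ex1[OF assms]] by (simp add: m_def bialgebra_monoid_def)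
  then have c: "\<Delta> (axis k 1) $ (i, j) = (if k = m then 1 else 0)" for k
    using bialgebra_coeff_ex1[OF assms, of i j] bialgebra_coeff_cases[OF assms, of k i j] by auto
  have "\<Delta> x $ (i, j) = (\<Sum>k\<in>UNIV. x $ k * \<Delta> (axis k 1) $ (i, j))"
    by (subst linear_axis_expansion[OF lin]) simp
  then show ?thesis
    by (simp add: c m_def if_distrib cong: if_cong)
qed

lemma counit_nth:
  fixes \<epsilon> :: "'k::field ^ 'n::finite \<Rightarrow> 'k"
  assumes "bialgebra_structure \<Delta> \<epsilon>"
  shows "\<epsilon> x = x $ \<one>\<^bsub>bialgebra_monoid \<Delta> \<epsilon>\<^esub>"
proof -
  have lin: "Vector_Spaces.linear (*s) (*) \<epsilon>"
    and mult: "\<And>x y. \<epsilon> (x * y) = \<epsilon> x * \<epsilon> y"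
    using assms by (auto simp: bialgebra_structure_def unital_algebra_hom_def)
  interpret Vector_Spaces.linear "(*s)" "(*)" \<epsilon> by (fact lin)
  define m where "m = \<one>\<^bsub>bialgebra_monoid \<Delta> \<epsilon>\<^esub>"
  have m: "\<epsilon> (axis m 1) = 1"
    using theI'[OF bialgebra_counit_ex1[OF assms]] by (simp add: m_def bialgebra_monoid_def)
  have "\<epsilon> x = \<epsilon> x * \<epsilon> (axis m 1)" by (simp add: m)
  also have "\<dots> = \<epsilon> (x $ m *s axis m 1)"
    unfolding mult[symmetric] by (rule arg_cong[where f = \<epsilon>]) (auto simp: vec_eq_iff axis_def)
  also have "\<dots> = x $ m" by (simp add: scale m)
  finally show ?thesis by (simp add: m_def)
qed

lemma monoid_bialgebra_monoid:
  fixes \<Delta> :: "'k::field ^ 'n::finite \<Rightarrow> 'k ^ ('n \<times> 'n)"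
  assumes B: "bialgebra_structure \<Delta> \<epsilon>"
  shows "monoid (bialgebra_monoid \<Delta> \<epsilon>)"
proof -
  let ?S = "bialgebra_monoid \<Delta> \<epsilon>"
  have coassoc: "tensor_assoc (tensor_map \<Delta> id (\<Delta> x)) = tensor_map id \<Delta> (\<Delta> x)"
    and l: "tensor_lift (\<lambda>u v. \<epsilon> u *s v) (\<Delta> x) = x"
    and r: "tensor_lift (\<lambda>u v. \<epsilon> v *s u) (\<Delta> x) = x" for x
    using B by (auto simp: bialgebra_structure_def coalgebra_structure_def)
  note nth = comult_nth[OF B] counit_nth[OF B]
  have pick: "(\<Sum>p\<in>UNIV. \<Sum>q\<in>UNIV. f p q * (axis p 1 $ i * axis q 1 $ j)) = f i j"
    for f :: "'n \<Rightarrow> 'n \<Rightarrow> 'k" and i j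
  proof -
    have "(\<Sum>q\<in>UNIV. f p q * (axis p 1 $ i * axis q 1 $ j)) = (if i = p then f p j else 0)" for p
    proof -
      have "f p q * (axis p 1 $ i * axis q 1 $ j) = (if j = q then if i = p then f p q else 0 else 0)"
        for q by (simp add: axis_def)
      then show ?thesis by simp
    qed
    then show ?thesis by simp
  qed
  have L: "tensor_map \<Delta> id t $ ((i, j), k) = t $ (i \<otimes>\<^bsub>?S\<^esub> j, k)" for t :: "'k ^ ('n \<times> 'n)" and i j k
    using pick[of "\<lambda>p q. t $ (p, q)" "i \<otimes>\<^bsub>?S\<^esub> j" k]
    by (simp add: tensor_map_def tensor_lift_def pure_tensor_def nth)
  have R: "tensor_map id \<Delta> t $ (i, (j, k)) = t $ (i, j \<otimes>\<^bsub>?S\<^esub> k)" for t :: "'k ^ ('n \<times> 'n)" and i j k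
    using pick[of "\<lambda>p q. t $ (p, q)" i "j \<otimes>\<^bsub>?S\<^esub> k"]
    by (simp add: tensor_map_def tensor_lift_def pure_tensor_def nth)
  have axis_eqD: "i = j" if "axis i (1 :: 'k) $ j = 1" for i j :: 'n
    using that by (auto simp: axis_def split: if_splits)
  show ?thesis
  proof (rule monoidI)
    fix i j k
    have "x $ ((i \<otimes>\<^bsub>?S\<^esub> j) \<otimes>\<^bsub>?S\<^esub> k) = x $ (i \<otimes>\<^bsub>?S\<^esub> (j \<otimes>\<^bsub>?S\<^esub> k))" for x :: "'k ^ 'n"
      using arg_cong[OF coassoc[of x], of "\<lambda>t. t $ (i, (j, k))"]
      by (simp add: tensor_assoc_def L R nth)
    from this[of "axis ((i \<otimes>\<^bsub>?S\<^esub> j) \<otimes>\<^bsub>?S\<^esub> k) 1"]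
    show "(i \<otimes>\<^bsub>?S\<^esub> j) \<otimes>\<^bsub>?S\<^esub> k = i \<otimes>\<^bsub>?S\<^esub> (j \<otimes>\<^bsub>?S\<^esub> k)"
      by (intro axis_eqD) simp
  next
    fix i
    have "x $ (\<one>\<^bsub>?S\<^esub> \<otimes>\<^bsub>?S\<^esub> i) = x $ i" for x :: "'k ^ 'n"
      using arg_cong[OF l[of x], of "\<lambda>t. t $ i"]
        pick[of "\<lambda>p q. \<Delta> x $ (p, q)" "\<one>\<^bsub>?S\<^esub>" i]
      by (simp add: tensor_lift_def nth mult.assoc)
    from this[of "axis i 1"] show "\<one>\<^bsub>?S\<^esub> \<otimes>\<^bsub>?S\<^esub> i = i"
      using axis_eqD[of i "\<one>\<^bsub>?S\<^esub> \<otimes>\<^bsub>?S\<^esub> i"] by simp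
    have "x $ (i \<otimes>\<^bsub>?S\<^esub> \<one>\<^bsub>?S\<^esub>) = x $ i" for x :: "'k ^ 'n"
      using arg_cong[OF r[of x], of "\<lambda>t. t $ i"]
        pick[of "\<lambda>p q. \<Delta> x $ (p, q)" i "\<one>\<^bsub>?S\<^esub>"]
      by (simp add: tensor_lift_def nth mult_ac)
    from this[of "axis i 1"] show "i \<otimes>\<^bsub>?S\<^esub> \<one>\<^bsub>?S\<^esub> = i"
      using axis_eqD[of i "i \<otimes>\<^bsub>?S\<^esub> \<one>\<^bsub>?S\<^esub>"] by simp
  qed (simp_all add: bialgebra_monoid_def)
qed

end

theory Submission
  imports Defs
begin

text \<open>
  The algebra \<open>\<k>\<^sup>n\<close> is the algebra of functions on its index set, and passing to functions is a
  contravariant equivalence: every unital algebra homomorphism \<open>\<k>\<^sup>m \<rightarrow> \<k>\<^sup>n\<close> is composition with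
  a unique map \<open>g\<close> of index sets in the opposite direction (\<open>unital_algebra_hom_iff_pullback\<close>),
  because each coordinate of the images of the \<open>e\<^sub>k\<close> is a complete system of orthogonal idempotents
  of the field \<open>\<k>\<close>, so that exactly one of them is \<open>1\<close>. Composition with \<open>g\<close> is bijective if and
  only if \<open>g\<close> is (\<open>bij_pullback_iff\<close>).

  Under the same dictionary a bialgebra structure on \<open>\<k>\<^sup>n\<close> is the one dual to its monoid:
  \<open>\<Delta>(x)\<close> is the function \<open>(i, j) \<mapsto> x(i \<cdot> j)\<close>, and \<open>\<epsilon>(x)\<close> is the value of \<open>x\<close> at the identity. The
  coordinate functions separate points, so composition with \<open>g\<close> respects \<open>\<Delta>\<close> and \<open>\<epsilon>\<close> if and only
  if \<open>g\<close> respects products and the identity (\<open>coalgebra_hom_pullback_iff\<close>). Thus the bialgebra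
  isomorphisms \<open>B\<^sub>1 \<rightarrow> B\<^sub>2\<close> are the pullbacks along the monoid isomorphisms \<open>S\<^sub>2 \<rightarrow> S\<^sub>1\<close>, and the
  latter exist exactly when there are isomorphisms \<open>S\<^sub>1 \<rightarrow> S\<^sub>2\<close>.
\<close>

definition pullback :: "('n \<Rightarrow> 'm) \<Rightarrow> 'k::field ^ 'm \<Rightarrow> 'k ^ 'n"
  where "pullback g x = (\<chi> i. x $ g i)"

lemma pullback_nth [simp]: "pullback g x $ i = x $ g i"
  by (simp add: pullback_def)

lemma linear_pullback: "Vector_Spaces.linear (*s) (*s) (pullback g)"
  by (rule vec_linearI) (simp_all add: vec_eq_iff)

lemma unital_algebra_hom_pullback: "unital_algebra_hom (*s) (*s) (pullback g)"
  by (simp add: unital_algebra_hom_def linear_pullback vec_eq_iff)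

text \<open>
  A homomorphism followed by the \<open>i\<close>-th coordinate is a character of \<open>\<k>\<^sup>m\<close>. Its values at the
  \<open>e\<^sub>k\<close> are orthogonal idempotents of \<open>\<k>\<close> with sum \<open>1\<close>; the index \<open>k\<close> at which the value is \<open>1\<close>
  is \<open>g i\<close>.
\<close>

lemma unital_algebra_hom_iff_pullback:
  fixes f :: "'k::field ^ 'm::finite \<Rightarrow> 'k ^ 'n::finite"
  shows "unital_algebra_hom (*s) (*s) f \<longleftrightarrow> (\<exists>g. f = pullback g)"
proof
  assume f: "unital_algebra_hom (*s) (*s) f"
  then have lin: "Vector_Spaces.linear (*s) (*s) f"
    and mult: "\<And>x y. f (x * y) = f x * f y" and one: "f 1 = 1"
    by (auto simp: unital_algebra_hom_def)
  define c where "c i k = f (axis k 1) $ i" for i k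
  have orth: "c i k * c i l = (if k = l then c i k else 0)" for i k l
    using arg_cong[OF mult[of "axis k 1" "axis l 1"], of "\<lambda>t. t $ i"]
    by (simp add: c_def axis_mult_axis vec.linear_0[OF lin] split: if_splits)
  have "(\<Sum>k\<in>UNIV. f (axis k 1)) = 1"
    by (simp add: one sum_axis flip: vec.linear_sum[OF lin])
  then have sum: "(\<Sum>k\<in>UNIV. c i k) = 1" for i
    by (simp add: c_def flip: sum_component)
  define g where "g i = (THE k. c i k = 1)" for i
  have ex1: "\<exists>!k. c i k = 1" and cases: "c i k = 1 \<or> c i k = 0" for i k
    using orthogonal_idempotents_ex1[of "c i", OF orth sum] by blast+
  have "c i (g i) = 1" for i
    unfolding g_def by (rule theI'[OF ex1])
  then have c: "c i k = (if k = g i then 1 else 0)" for i k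
    using ex1[of i] cases[of i k] by auto
  have "f x $ i = x $ g i" for x i
  proof -
    have "f x $ i = (\<Sum>k\<in>UNIV. x $ k * c i k)"
      by (subst linear_axis_expansion[OF lin]) (simp add: c_def)
    then show ?thesis
      by (simp add: c if_distrib cong: if_cong)
  qed
  then show "\<exists>g. f = pullback g"
    by (intro exI[of _ g]) (simp add: fun_eq_iff vec_eq_iff)
qed (auto simp: unital_algebra_hom_pullback)

lemma bij_pullback_iff:
  fixes g :: "'n::finite \<Rightarrow> 'm::finite"
  shows "bij (pullback g :: 'k::field ^ 'm \<Rightarrow> 'k ^ 'n) \<longleftrightarrow> bij g"
proof
  let ?f = "pullback g :: 'k ^ 'm \<Rightarrow> 'k ^ 'n"
  assume f: "bij ?f"
  have "inj g"
  proof (rule injI)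
    fix i j assume "g i = g j"
    obtain x where "axis i 1 = ?f x"
      using f by (meson bij_pointE)
    then have "axis i (1 :: 'k) $ i = axis i 1 $ j"
      using \<open>g i = g j\<close> by simp
    then show "i = j"
      by (simp add: axis_def split: if_splits)
  qed
  moreover have "surj g"
  proof (rule ccontr)
    assume "\<not> surj g"
    then obtain k where "k \<notin> range g" by blast
    \<comment> \<open>A function supported off the range of \<open>g\<close> is killed by composition with \<open>g\<close>.\<close>
    then have "?f (axis k 1) = ?f 0"
      by (auto simp: vec_eq_iff axis_def)
    then show False
      using bij_is_inj[OF f] by (auto dest: injD)
  qed
  ultimately show "bij g" by (simp add: bij_def)
next
  assume g: "bij g"
  show "bij (pullback g :: 'k ^ 'm \<Rightarrow> 'k ^ 'n)"
  proof (rule o_bij)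
    show "pullback (inv_into UNIV g) \<circ> pullback g = (id :: 'k ^ 'm \<Rightarrow> 'k ^ 'm)"
      using g by (simp add: fun_eq_iff vec_eq_iff bij_is_surj surj_f_inv_f)
    show "pullback g \<circ> pullback (inv_into UNIV g) = (id :: 'k ^ 'n \<Rightarrow> 'k ^ 'n)"
      using g by (simp add: fun_eq_iff vec_eq_iff bij_is_inj)
  qed
qed

text \<open>By the universal property it suffices to compare both maps on pure tensors.\<close>

lemma tensor_map_pullback:
  fixes g :: "'n::finite \<Rightarrow> 'm::finite" and h :: "'q::finite \<Rightarrow> 'p::finite"
  shows "tensor_map (pullback g) (pullback h) =
    (pullback (map_prod g h) :: 'k::field ^ ('m \<times> 'p) \<Rightarrow> 'k ^ ('n \<times> 'q))"
proof -
  let ?b = "\<lambda>(u :: 'k ^ 'm) (v :: 'k ^ 'p). pure_tensor (pullback g u) (pullback h v)"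
  have "bilinear_map ?b"
    unfolding bilinear_map_def
    by (auto intro!: vec_linearI simp: pure_tensor_def vec_eq_iff algebra_simps)
  moreover have "\<forall>u v. pullback (map_prod g h) (pure_tensor u v) = ?b u v"
    by (simp add: pure_tensor_def vec_eq_iff)
  ultimately have "pullback (map_prod g h) = tensor_lift ?b"
    by (intro iffD1[OF tensor_universal]) (auto simp: linear_pullback)
  then show ?thesis
    by (simp add: tensor_map_def)
qed

text \<open>
  The coalgebra equations for \<open>pullback g\<close> say that \<open>x(g(i \<cdot> j)) = x(g i \<cdot> g j)\<close> and \<open>x(g 1) = x(1)\<close>
  for all functions \<open>x\<close>; indicator functions separate points, so these are the equations for \<open>g\<close>
  itself.
\<close>

lemma coalgebra_hom_pullback_iff:
  fixes \<Delta>1 :: "'k::field ^ 'm::finite \<Rightarrow> 'k ^ ('m \<times> 'm)"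
    and \<Delta>2 :: "'k ^ 'n::finite \<Rightarrow> 'k ^ ('n \<times> 'n)"
  assumes B1: "bialgebra_structure \<Delta>1 \<epsilon>1" and B2: "bialgebra_structure \<Delta>2 \<epsilon>2"
  shows "coalgebra_hom \<Delta>1 \<epsilon>1 \<Delta>2 \<epsilon>2 (pullback g) \<longleftrightarrow>
    g \<in> hom (bialgebra_monoid \<Delta>2 \<epsilon>2) (bialgebra_monoid \<Delta>1 \<epsilon>1) \<and>
    g \<one>\<^bsub>bialgebra_monoid \<Delta>2 \<epsilon>2\<^esub> = \<one>\<^bsub>bialgebra_monoid \<Delta>1 \<epsilon>1\<^esub>"
proof -
  let ?S1 = "bialgebra_monoid \<Delta>1 \<epsilon>1" and ?S2 = "bialgebra_monoid \<Delta>2 \<epsilon>2"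
  have separate: "(\<forall>x :: 'k ^ 'm. x $ p = x $ q) \<longleftrightarrow> p = q" for p q
  proof
    assume "\<forall>x :: 'k ^ 'm. x $ p = x $ q"
    then have "axis p (1 :: 'k) $ p = axis p 1 $ q" by blast
    then show "p = q" by (simp add: axis_def split: if_splits)
  qed simp
  have "(\<forall>x. \<Delta>2 (pullback g x) = tensor_map (pullback g) (pullback g) (\<Delta>1 x)) \<longleftrightarrow>
      (\<forall>i j. \<forall>x :: 'k ^ 'm. x $ g (i \<otimes>\<^bsub>?S2\<^esub> j) = x $ (g i \<otimes>\<^bsub>?S1\<^esub> g j))"
    by (auto simp: vec_eq_iff tensor_map_pullback comult_nth[OF B1] comult_nth[OF B2])
  also have "\<dots> \<longleftrightarrow> g \<in> hom ?S2 ?S1"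
    unfolding separate by (simp add: hom_def bialgebra_monoid_def)
  finally have comult: "(\<forall>x. \<Delta>2 (pullback g x) = tensor_map (pullback g) (pullback g) (\<Delta>1 x))
    \<longleftrightarrow> g \<in> hom ?S2 ?S1" .
  have counit: "(\<forall>x. \<epsilon>2 (pullback g x) = \<epsilon>1 x) \<longleftrightarrow> g \<one>\<^bsub>?S2\<^esub> = \<one>\<^bsub>?S1\<^esub>"
    by (simp add: counit_nth[OF B1] counit_nth[OF B2] separate)
  show ?thesis
    by (simp add: coalgebra_hom_def linear_pullback comult counit)
qed

lemma monoid_isomorphic_sym:
  assumes "monoid S" and iso: "monoid_isomorphic S T"
  shows "monoid_isomorphic T S"
proof -
  interpret monoid S by fact
  obtain h where h: "h \<in> iso S T" and one: "h \<one>\<^bsub>S\<^esub> = \<one>\<^bsub>T\<^esub>"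
    using iso by (auto simp: monoid_isomorphic_def)
  let ?k = "inv_into (carrier S) h"
  have bij: "bij_betw h (carrier S) (carrier T)" and hom: "h \<in> hom S T"
    using h by (auto simp: iso_def)
  have k: "bij_betw ?k (carrier T) (carrier S)"
    by (rule bij_betw_inv_into[OF bij])
  have "?k (x \<otimes>\<^bsub>T\<^esub> y) = ?k x \<otimes>\<^bsub>S\<^esub> ?k y" if "x \<in> carrier T" "y \<in> carrier T" for x y
  proof -
    have closed: "?k x \<in> carrier S" "?k y \<in> carrier S"
      using that bij_betwE[OF k] by blast+
    then have "h (?k x \<otimes>\<^bsub>S\<^esub> ?k y) = x \<otimes>\<^bsub>T\<^esub> y"
      using that by (simp add: hom_mult[OF hom] bij_betw_inv_into_right[OF bij])
    then show ?thesis
      using closed bij_betw_inv_into_left[OF bij, of "?k x \<otimes>\<^bsub>S\<^esub> ?k y"] by simp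
  qed
  then have "?k \<in> iso T S"
    using k bij_betwE[OF k] by (auto simp: iso_def hom_def)
  moreover have "?k \<one>\<^bsub>T\<^esub> = \<one>\<^bsub>S\<^esub>"
    using bij_betw_inv_into_left[OF bij one_closed] by (simp add: one)
  ultimately show ?thesis
    by (auto simp: monoid_isomorphic_def)
qed

theorem theorem3p7:
  fixes \<Delta>1 \<Delta>2 :: "'k::field ^ 'n::finite \<Rightarrow> 'k ^ ('n \<times> 'n)"
    and \<epsilon>1 \<epsilon>2 :: "'k ^ 'n \<Rightarrow> 'k"
  assumes "bialgebra_structure \<Delta>1 \<epsilon>1"
    and "bialgebra_structure \<Delta>2 \<epsilon>2"
  shows "bialgebra_isomorphic \<Delta>1 \<epsilon>1 \<Delta>2 \<epsilon>2 \<longleftrightarrow>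
    monoid_isomorphic (bialgebra_monoid \<Delta>1 \<epsilon>1) (bialgebra_monoid \<Delta>2 \<epsilon>2)"
proof -
  let ?S1 = "bialgebra_monoid \<Delta>1 \<epsilon>1" and ?S2 = "bialgebra_monoid \<Delta>2 \<epsilon>2"
  have "bialgebra_isomorphic \<Delta>1 \<epsilon>1 \<Delta>2 \<epsilon>2 \<longleftrightarrow>
      (\<exists>g. bij (pullback g :: 'k ^ 'n \<Rightarrow> 'k ^ 'n) \<and>
        coalgebra_hom \<Delta>1 \<epsilon>1 \<Delta>2 \<epsilon>2 (pullback g))"
    unfolding bialgebra_isomorphic_def unital_algebra_hom_iff_pullback by blast
  also have "\<dots> \<longleftrightarrow> (\<exists>g. bij g \<and> g \<in> hom ?S2 ?S1 \<and> g \<one>\<^bsub>?S2\<^esub> = \<one>\<^bsub>?S1\<^esub>)"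
    by (simp add: bij_pullback_iff coalgebra_hom_pullback_iff[OF assms])
  also have "\<dots> \<longleftrightarrow> monoid_isomorphic ?S2 ?S1"
    by (auto simp: monoid_isomorphic_def iso_def bialgebra_monoid_def)
  also have "\<dots> \<longleftrightarrow> monoid_isomorphic ?S1 ?S2"
    using monoid_isomorphic_sym monoid_bialgebra_monoid assms by blast
  finally show ?thesis .
qed

end
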